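(* Let $m,n,s$ be integers with $2\le 2s\le m\le n$. If $\mathbf A$ is a real $m\times n$ matrix with $\delta_{2s}(\mathbf A)\in(0,1)$, then there exists $q$ with $0<q\le 1$ such that every $s$-sparse vector $\mathbf x\in\mathbb R^n$ can be exactly recovered by solving the $\ell^q$-minimization problem $$\min\|\mathbf y\|_q\quad\text{subject to}\quad \mathbf A\mathbf y=\mathbf A\mathbf x,$$ i.e. for every $s$-sparse $\mathbf x$, the vector $\mathbf x$ is the unique solution of this minimization problem over $\mathbf y\in\mathbb R^n$.
   Context: For $\mathbf x=(x_1,\dots,x_n)^T\in\mathbb R^n$ and $0<q<\infty$, $\|\mathbf x\|_q=(|x_1|^q+\cdots+|x_n|^q)^{1/q}$. A vector is $s$-sparse if it has at most $s$ nonzero components; $\Sigma_s$ is the set of $s$-sparse vectors in $\mathbb R^n$. The restricted isometry constant $\delta_k(\mathbf A)$ of order $k$ is the smallest $\delta\ge0$ such that $(1-\delta)\|\mathbf x\|_2^2\le\|\mathbf A\mathbf x\|_2^2\le(1+\delta)\|\mathbf x\|_2^2$ for all $\mathbf x\in\Sigma_k$. *)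

theory Defs
  imports "HOL-Analysis.Analysis"
begin

definition lq_norm :: "real \<Rightarrow> real ^ 'n \<Rightarrow> real" where
  "lq_norm q x = (\<Sum>i\<in>UNIV. \<bar>x $ i\<bar> powr q) powr (1 / q)"

lemma lq_norm_2: "lq_norm 2 x = norm x"
  by (simp add: lq_norm_def norm_vec_def L2_set_def powr_half_sqrt sum_nonneg)

definition sparse_vectors :: "nat \<Rightarrow> (real ^ 'n) set" where
  "sparse_vectors s = {x. card {i. x $ i \<noteq> 0} \<le> s}"

definition rip_bound :: "real ^ 'n ^ 'm \<Rightarrow> nat \<Rightarrow> real \<Rightarrow> bool" where
  "rip_bound A k \<delta> \<longleftrightarrow> 0 \<le> \<delta> \<and>
     (\<forall>x\<in>sparse_vectors k.
        (1 - \<delta>) * (norm x)\<^sup>2 \<le> (norm (A *v x))\<^sup>2 \<and>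
        (norm (A *v x))\<^sup>2 \<le> (1 + \<delta>) * (norm x)\<^sup>2)"

definition ric :: "real ^ 'n ^ 'm \<Rightarrow> nat \<Rightarrow> real" where
  "ric A k = (LEAST \<delta>. rip_bound A k \<delta>)"

text \<open>The least element exists, so \<open>ric\<close> is never an arbitrary value of \<open>LEAST\<close>.\<close>

lemma
  shows rip_bound_ric: "rip_bound A k (ric A k)"
    and ric_le: "rip_bound A k \<delta> \<Longrightarrow> ric A k \<le> \<delta>"
proof -
  let ?S = "{\<delta>. rip_bound A k \<delta>}"
  obtain B where B: "\<And>x. norm (A *v x) \<le> norm x * B"
    using bounded_linear.bounded[OF matrix_vector_mul_bounded_linear[of A]] by blast
  have "rip_bound A k (max 1 (B\<^sup>2))"
    unfolding rip_bound_def
  proof (intro conjI ballI)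
    fix x :: "real ^ 'a"
    have "(1 - max 1 (B\<^sup>2)) * (norm x)\<^sup>2 \<le> 0"
      by (intro mult_nonpos_nonneg) auto
    then show "(1 - max 1 (B\<^sup>2)) * (norm x)\<^sup>2 \<le> (norm (A *v x))\<^sup>2"
      by (meson order_trans zero_le_power2)
    have "(norm (A *v x))\<^sup>2 \<le> (norm x * B)\<^sup>2"
      using B[of x] by (intro power_mono) auto
    also have "\<dots> = B\<^sup>2 * (norm x)\<^sup>2"
      by (simp add: power_mult_distrib)
    also have "\<dots> \<le> (1 + max 1 (B\<^sup>2)) * (norm x)\<^sup>2"
      by (intro mult_right_mono) auto
    finally show "(norm (A *v x))\<^sup>2 \<le> (1 + max 1 (B\<^sup>2)) * (norm x)\<^sup>2" .
  qed simp
  then have ne: "?S \<noteq> {}" by blast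
  have bdd: "bdd_below ?S"
    by (rule bdd_belowI[of _ 0]) (simp add: rip_bound_def)
  have "closed ?S"
    unfolding rip_bound_def Ball_def
    by (intro closed_Collect_conj closed_Collect_all closed_Collect_imp open_Collect_const
        closed_Collect_le continuous_intros)
  then have mem: "rip_bound A k (Inf ?S)"
    using closed_contains_Inf[OF ne bdd] by blast
  have le: "Inf ?S \<le> d" if "rip_bound A k d" for d
    using that bdd by (auto intro: cInf_lower)
  have eq: "ric A k = Inf ?S"
    unfolding ric_def by (rule Least_equality[where P = "rip_bound A k"]) (use mem le in auto)
  show "rip_bound A k (ric A k)" using mem eq by simp
  show "rip_bound A k \<delta> \<Longrightarrow> ric A k \<le> \<delta>" using le eq by simp
qed

end

theory Submission
  imports Defs
begin

text \<open>
  A nonzero kernel vector of \<open>A\<close> has more than \<open>2s\<close> entries that are comparable to its norm,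
  uniformly over the kernel: otherwise its few large entries would form a \<open>2s\<close>-sparse vector
  that \<open>A\<close> nearly annihilates. As \<open>q\<close> tends to \<open>0\<close>, the \<open>q\<close>-th powers of these relative sizes
  tend uniformly to \<open>1\<close>, so the \<open>s\<close> entries on any set of size \<open>s\<close> contribute less to
  \<open>\<Sum>\<bar>h\<^sub>i\<bar> powr q\<close> than the remaining ones. This is the null space property, which gives
  recovery by subadditivity of \<open>t \<mapsto> t powr q\<close>.
\<close>

text \<open>Dividing by \<open>a + b\<close> leaves two numbers in [0,1] with sum 1, and on that
  interval \<open>u \<le> u powr q\<close> because \<open>q \<le> 1\<close>.\<close>

lemma powr_add_le:
  fixes a b q :: real
  assumes "0 \<le> a" "0 \<le> b" "0 \<le> q" "q \<le> 1"
  shows "(a + b) powr q \<le> a powr q + b powr q"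
proof (cases "a + b = 0")
  case False
  then have pos: "a + b > 0" using assms by simp
  have *: "u \<le> u powr q" if "0 \<le> u" "u \<le> 1" for u :: real
  proof (cases "u = 0")
    case False
    then show ?thesis using powr_mono'[of q 1 u] that assms by simp
  qed simp
  have "1 = a / (a + b) + b / (a + b)"
    using pos by (simp add: add_divide_distrib[symmetric])
  also have "\<dots> \<le> (a / (a + b)) powr q + (b / (a + b)) powr q"
    using assms pos by (intro add_mono *) auto
  also have "\<dots> = (a powr q + b powr q) / (a + b) powr q"
    using assms pos by (simp add: powr_divide add_divide_distrib)
  finally show ?thesis
    using pos by (simp add: field_simps)
qed (use assms in auto)

lemma ex_powr_gt:
  fixes c d :: real
  assumes "0 < c" "d < 1"
  shows "\<exists>q. 0 < q \<and> q \<le> 1 \<and> d < c powr q"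
proof -
  have "((\<lambda>q. c powr q) \<longlongrightarrow> c powr 0) (at_right 0)"
    using assms by (intro tendsto_intros) auto
  then have "eventually (\<lambda>q. d < c powr q) (at_right 0)"
    using assms by (intro order_tendstoD(1)[where y = "c powr 0"]) auto
  moreover have "eventually (\<lambda>q. q \<in> {0<..<1::real}) (at_right 0)"
    by (rule eventually_at_right_real) simp
  ultimately have "eventually (\<lambda>q. d < c powr q \<and> q \<in> {0<..<1}) (at_right 0)"
    by eventually_elim simp
  then obtain q where "d < c powr q" "q \<in> {0<..<1}"
    using eventually_happens'[OF trivial_limit_at_right_real] by blast
  then show ?thesis by (intro exI[of _ q]) auto
qed

text \<open>Splitting a kernel vector as \<open>h = t + r\<close> gives
  \<open>A *v t = - (A *v r)\<close>, so a sparse \<open>t\<close> is controlled by the remainder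
  \<open>r\<close>. If all entries of \<open>r\<close> are tiny, then so is \<open>h\<close>, which
  is absurd. The constant \<open>c\<close> is the same for every \<open>h\<close>; this uniformity
  later allows a single \<open>q\<close>.\<close>

lemma kernel_many_large_entries:
  fixes A :: "real ^ 'n ^ 'm"
  assumes "0 < a" and lower: "\<And>x. x \<in> sparse_vectors k \<Longrightarrow> a * norm x \<le> norm (A *v x)"
  shows "\<exists>c>0. \<forall>h. A *v h = 0 \<longrightarrow> h \<noteq> 0 \<longrightarrow> k < card {i. c * norm h \<le> \<bar>h $ i\<bar>}"
proof -
  obtain B where "B > 0" and B: "\<And>x. norm (A *v x) \<le> norm x * B"
    using bounded_linear.pos_bounded[OF matrix_vector_mul_bounded_linear[of A]] by blast
  define N where "N = real CARD('n)"
  have "N > 0" by (simp add: N_def)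
  define D where "D = (a + B) * N"
  have "D > 0" using \<open>0 < a\<close> \<open>0 < B\<close> \<open>0 < N\<close> by (simp add: D_def)
  \<comment> \<open>This value makes the final estimate read
    \<open>a * norm h \<le> a / 2 * norm h\<close>, a contradiction. The factor \<open>N\<close> in
    \<open>D\<close> is the cost of bounding \<open>norm r\<close> by the sum of its
    entries.\<close>
  define c where "c = a / (2 * D)"
  have "c > 0" using \<open>0 < a\<close> \<open>0 < D\<close> by (simp add: c_def)
  have c: "(a + B) * (N * c) = a / 2"
    using \<open>0 < D\<close> by (simp add: c_def mult.assoc[symmetric] D_def[symmetric])
  have "k < card {i. c * norm h \<le> \<bar>h $ i\<bar>}" if "A *v h = 0" "h \<noteq> 0" for h
  proof (rule ccontr)
    assume few: "\<not> k < card {i. c * norm h \<le> \<bar>h $ i\<bar>}"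
    define t :: "real ^ 'n" where "t = (\<chi> i. if c * norm h \<le> \<bar>h $ i\<bar> then h $ i else 0)"
    define r where "r = h - t"
    have "card {i. t $ i \<noteq> 0} \<le> card {i. c * norm h \<le> \<bar>h $ i\<bar>}"
      by (intro card_mono) (auto simp: t_def)
    then have "t \<in> sparse_vectors k" using few by (simp add: sparse_vectors_def)
    then have "a * norm t \<le> norm (A *v t)" by (rule lower)
    also have "A *v t = - (A *v r)"
      using \<open>A *v h = 0\<close> by (simp add: r_def matrix_vector_mult_diff_distrib)
    also have "norm (- (A *v r)) \<le> B * norm r" using B[of r] by (simp add: mult.commute)
    finally have t: "a * norm t \<le> B * norm r" .
    have "norm r \<le> (\<Sum>i\<in>UNIV. \<bar>r $ i\<bar>)" by (rule norm_le_l1_cart)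
    also have "\<dots> \<le> (\<Sum>i\<in>(UNIV :: 'n set). c * norm h)"
      using \<open>c > 0\<close> by (intro sum_mono) (auto simp: r_def t_def)
    finally have r: "norm r \<le> N * c * norm h" by (simp add: N_def)
    have "norm h \<le> norm t + norm r"
      using norm_triangle_ineq[of t r] by (simp add: r_def)
    then have "a * norm h \<le> a * (norm t + norm r)" using \<open>0 < a\<close> by simp
    also have "\<dots> \<le> (a + B) * norm r" using t by (simp add: algebra_simps)
    also have "\<dots> \<le> (a + B) * (N * c * norm h)"
      using r \<open>0 < a\<close> \<open>0 < B\<close> by (intro mult_left_mono) auto
    also have "\<dots> = a / 2 * norm h" using c by (metis mult.assoc)
    finally show False using \<open>0 < a\<close> \<open>h \<noteq> 0\<close> by simp
  qed
  then show ?thesis using \<open>c > 0\<close> by blast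
qed

text \<open>The set \<open>S\<close> carries at most \<open>s * norm h powr q\<close>. Outside
  \<open>S\<close> at least \<open>s + 1\<close> large entries remain, each contributing at least
  \<open>(c * norm h) powr q\<close>. The bound on \<open>c powr q\<close> says exactly that
  \<open>s < (s + 1) * c powr q\<close>.\<close>

lemma lq_null_space_property:
  fixes h :: "real ^ 'n"
  assumes "0 < c" "0 \<le> q" and cq: "real s / (real s + 1) < c powr q"
    and large: "2 * s < card {i. c * norm h \<le> \<bar>h $ i\<bar>}"
    and "card S \<le> s" and "h \<noteq> 0"
  shows "(\<Sum>i\<in>S. \<bar>h $ i\<bar> powr q) < (\<Sum>i\<in>-S. \<bar>h $ i\<bar> powr q)"
proof -
  define L where "L = {i. c * norm h \<le> \<bar>h $ i\<bar>}"
  define M where "M = norm h powr q"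
  have "M > 0" using \<open>h \<noteq> 0\<close> by (simp add: M_def)
  \<comment> \<open>More than \<open>2 * s\<close> large entries, less at most \<open>s\<close>,
    leave one more than \<open>s\<close>. This surplus keeps the threshold
    \<open>s / (s + 1)\<close> below 1, hence within reach of \<open>c powr q\<close> for small
    \<open>q\<close>.\<close>
  have "card L - card S \<le> card (L - S)" by (rule diff_card_le_card_Diff) simp
  then have "s + 1 \<le> card (L - S)" using large \<open>card S \<le> s\<close> by (simp add: L_def)
  then have card: "real s + 1 \<le> real (card (L - S))" by linarith
  have "(\<Sum>i\<in>S. \<bar>h $ i\<bar> powr q) \<le> (\<Sum>i\<in>S. M)"
    unfolding M_def using \<open>0 \<le> q\<close> by (intro sum_mono powr_mono2 component_le_norm_cart) auto
  also have "\<dots> \<le> real s * M" using \<open>card S \<le> s\<close> \<open>M > 0\<close> by simp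
  also have "\<dots> < (real s + 1) * (c powr q) * M"
    using cq \<open>M > 0\<close> by (intro mult_strict_right_mono) (simp_all add: field_simps)
  also have "\<dots> \<le> real (card (L - S)) * (c powr q) * M"
    using card \<open>M > 0\<close> by (intro mult_right_mono) auto
  also have "\<dots> = (\<Sum>i\<in>L - S. (c * norm h) powr q)"
    using \<open>0 < c\<close> by (simp add: M_def powr_mult)
  also have "\<dots> \<le> (\<Sum>i\<in>L - S. \<bar>h $ i\<bar> powr q)"
    using \<open>0 < c\<close> \<open>0 \<le> q\<close> by (intro sum_mono powr_mono2) (auto simp: L_def)
  also have "\<dots> \<le> (\<Sum>i\<in>-S. \<bar>h $ i\<bar> powr q)"
    by (intro sum_mono2) auto
  finally show ?thesis .
qed

text \<open>On the support of \<open>x\<close>, passing to \<open>x + h\<close> lowers the sum of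
  powers by at most the part of \<open>h\<close> there, by subadditivity. Off the support the sum
  grows by the whole remaining part of \<open>h\<close>, which is larger by
  \<open>nsp\<close>.\<close>

lemma lq_norm_less_add:
  fixes x h :: "real ^ 'n"
  assumes "0 < q" "q \<le> 1"
    and nsp: "(\<Sum>i | x $ i \<noteq> 0. \<bar>h $ i\<bar> powr q) < (\<Sum>i\<in>-{i. x $ i \<noteq> 0}. \<bar>h $ i\<bar> powr q)"
  shows "lq_norm q x < lq_norm q (x + h)"
proof -
  define S where "S = {i. x $ i \<noteq> 0}"
  have split: "(\<Sum>i\<in>UNIV. f i) = (\<Sum>i\<in>S. f i) + (\<Sum>i\<in>-S. f i)" for f :: "'n \<Rightarrow> real"
    using sum.union_disjoint[of S "-S" f] by simp
  have "\<bar>x $ i\<bar> powr q \<le> \<bar>(x + h) $ i\<bar> powr q + \<bar>h $ i\<bar> powr q" for i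
  proof -
    have "\<bar>x $ i\<bar> powr q \<le> (\<bar>(x + h) $ i\<bar> + \<bar>h $ i\<bar>) powr q"
      using assms by (intro powr_mono2) auto
    also have "\<dots> \<le> \<bar>(x + h) $ i\<bar> powr q + \<bar>h $ i\<bar> powr q"
      using assms by (intro powr_add_le) auto
    finally show ?thesis .
  qed
  then have "(\<Sum>i\<in>S. \<bar>x $ i\<bar> powr q) \<le> (\<Sum>i\<in>S. \<bar>(x + h) $ i\<bar> powr q) + (\<Sum>i\<in>S. \<bar>h $ i\<bar> powr q)"
    by (simp only: sum.distrib[symmetric]) (rule sum_mono)
  moreover have "(\<Sum>i\<in>-S. \<bar>x $ i\<bar> powr q) = 0"
    by (simp add: S_def)
  moreover have "(\<Sum>i\<in>-S. \<bar>(x + h) $ i\<bar> powr q) = (\<Sum>i\<in>-S. \<bar>h $ i\<bar> powr q)"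
    by (intro sum.cong) (auto simp: S_def)
  ultimately have "(\<Sum>i\<in>UNIV. \<bar>x $ i\<bar> powr q) < (\<Sum>i\<in>UNIV. \<bar>(x + h) $ i\<bar> powr q)"
    using nsp split[of "\<lambda>i. \<bar>x $ i\<bar> powr q"] split[of "\<lambda>i. \<bar>(x + h) $ i\<bar> powr q"]
    unfolding S_def by linarith
  then show ?thesis
    unfolding lq_norm_def using \<open>0 < q\<close> by (intro powr_less_mono2) (auto intro: sum_nonneg)
qed

theorem theorem1p2:
  fixes A :: "real ^ 'n ^ 'm" and s :: nat
  assumes "2 \<le> 2 * s" and "2 * s \<le> CARD('m)" and "CARD('m) \<le> CARD('n)"
    and "ric A (2 * s) \<in> {0<..<1}"
  shows "\<exists>q. 0 < q \<and> q \<le> 1 \<and>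
    (\<forall>x\<in>sparse_vectors s. {y. is_arg_min (lq_norm q) (\<lambda>y. A *v y = A *v x) y} = {x})"
proof -
  \<comment> \<open>The square root turns the lower restricted isometry inequality for squares into
    one for norms.\<close>
  define a where "a = sqrt (1 - ric A (2 * s))"
  have "a > 0" using assms(4) by (simp add: a_def)
  have "a * norm x \<le> norm (A *v x)" if "x \<in> sparse_vectors (2 * s)" for x
  proof (rule power2_le_imp_le)
    show "(a * norm x)\<^sup>2 \<le> (norm (A *v x))\<^sup>2"
      using rip_bound_ric[of A "2 * s"] that assms(4)
      by (simp add: rip_bound_def a_def power_mult_distrib)
  qed simp
  from kernel_many_large_entries[OF \<open>a > 0\<close> this]
  obtain c where "c > 0"
    and c: "\<And>h. A *v h = 0 \<Longrightarrow> h \<noteq> 0 \<Longrightarrow> 2 * s < card {i. c * norm h \<le> \<bar>h $ i\<bar>}"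
    by blast
  \<comment> \<open>Only \<open>c\<close> and \<open>s\<close> enter the choice of \<open>q\<close>,
    so one exponent serves all sparse \<open>x\<close>.\<close>
  obtain q where q: "0 < q" "q \<le> 1" "real s / (real s + 1) < c powr q"
    using ex_powr_gt[OF \<open>c > 0\<close>, of "real s / (real s + 1)"] by auto
  have less: "lq_norm q x < lq_norm q y"
    if "x \<in> sparse_vectors s" "A *v y = A *v x" "y \<noteq> x" for x y
  proof -
    \<comment> \<open>The kernel vector is \<open>h = y - x\<close>, and \<open>S\<close> is the
      support of \<open>x\<close>, of size at most \<open>s\<close>.\<close>
    have "A *v (y - x) = 0" "y - x \<noteq> 0"
      using that by (simp_all add: matrix_vector_mult_diff_distrib)
    then have "lq_norm q x < lq_norm q (x + (y - x))"
      using that(1) q \<open>c > 0\<close>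
      by (intro lq_norm_less_add lq_null_space_property[where c = c and s = s] c)
        (simp_all add: sparse_vectors_def)
    then show ?thesis by simp
  qed
  \<comment> \<open>The vector \<open>x\<close> is itself feasible and strictly beats every other
    feasible \<open>y\<close>, which gives both minimality and uniqueness.\<close>
  have "{y. is_arg_min (lq_norm q) (\<lambda>y. A *v y = A *v x) y} = {x}"
    if "x \<in> sparse_vectors s" for x
    using less[OF that] by (force simp: is_arg_min_def)
  then show ?thesis using q by blast
qed

end
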